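(* Let $G=(V,E,I,\varsigma,\omega,\sigma)$ be an oriented hypergraph with Laplacian matrix $\mathbf{L}_G$, and let $\mathbf{X}=(x_{u,w})_{u,w\in V}$ be the $V\times V$ matrix of independent indeterminates. Then the total-minor polynomial $\chi(\mathbf{L}_G,\mathbf{X}):=\det(\mathbf{X}-\mathbf{L}_G)$ satisfies $$\chi(\mathbf{L}_G,\mathbf{X})=\sum_{[\mathbf{u},\mathbf{w}]}\left(\sum_{c\in\hat{\mathfrak{M}}_{\neq 0}(G^0;\mathbf{u},\mathbf{w})}\operatorname{csgn}(c)\right)\prod_i x_{u_i,w_i},$$ where $\hat{\mathfrak{M}}_{\neq 0}(G^0;\mathbf{u},\mathbf{w})$ is the set of edge-monic non-zero reduced $[\mathbf{u},\mathbf{w}]$-equivalent contributors.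
   Context: An oriented hypergraph is a sextuple $G=(V,E,I,\varsigma,\omega,\sigma)$ with finite sets $V$ (vertices), $E$ (edges), $I$ (incidences) and functions $\varsigma:I\to V$ (port), $\omega:I\to E$ (attachment), $\sigma:I\to\{+1,-1\}$ (incidence signs). Several incidences may have the same port and attachment. The incidence matrix $\mathbf{H}_G$ is the $V\times E$ matrix whose $(v,e)$-entry is the sum of $\sigma(i)$ over all $i\in I$ with $\varsigma(i)=v$, $\omega(i)=e$. The Laplacian is $\mathbf{L}_G=\mathbf{H}_G\mathbf{H}_G^{T}$. The outer sum is over all pairs $[\mathbf{u},\mathbf{w}]$ consisting of subsets $U,W\subseteq V$ with $|U|=|W|$ and a bijection $U\to W$, written $u_i\mapsto w_i$ with $\mathbf{u}=(u_1,u_2,\dots)$, $\mathbf{w}=(w_1,w_2,\dots)$ orderings of $U$ and $W$; each triple ($U$, $W$, bijection) is counted exactly once, and $U=W=\emptyset$ and $U=W=V$ are allowed. A contributor of a hypergraph assigns to every $v\in V$ a step $(v,i_v,e_v,j_v,\pi(v))$, where $i_v,j_v$ are incidences (possibly equal), $\omega(i_v)=\omega(j_v)=e_v$, $\varsigma(i_v)=v$, $\varsigma(j_v)=\pi(v)$, such that $\pi$ is a permutation of $V$. A $[\mathbf{u},\mathbf{w}]$-reduced contributor is what remains of a contributor with $\pi(u_i)=w_i$ for all $i$ after the steps at the vertices $u_i$ are removed. These are formed in the zero-loading $G^0$ of $G$ (in which missing incidences are added with weight $0$, so that the removed steps need not exist in $G$), and "non-zero" means that all the remaining steps lie in $G$.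 Concretely, an element of $\hat{\mathfrak{C}}_{\neq0}(G^0;\mathbf{u},\mathbf{w})$ is a family $c$ of steps $(v,i_v,e_v,j_v,\pi(v))$ of $G$, one for each $v\in V\setminus U$, with $\omega(i_v)=\omega(j_v)=e_v$, $\varsigma(i_v)=v$, $\varsigma(j_v)=\pi(v)$, such that $\pi$ is a bijection $V\setminus U\to V\setminus W$. Such a $c$ is edge-monic if $e_v\ne e_w$ for all distinct $v,w\in V\setminus U$; $\hat{\mathfrak{M}}_{\neq0}(G^0;\mathbf{u},\mathbf{w})$ denotes the subset of edge-monic elements. The step at $v$ is a backstep if $i_v=j_v$; otherwise it is an adjacency (a loop if moreover $\pi(v)=v$). The contributor sign is $\operatorname{csgn}(c)=(-1)^{ec(\check c)+nc(c)+bs(c)}$, where: $ec(\check c)$ is the number of cycles of even length of the permutation of $V$ that extends $\pi$ by $u_i\mapsto w_i$; $bs(c)$ is the number of backsteps of $c$; and $nc(c)$ is the number of negative components of $c$. The components of $c$ are those of the directed graph on $V$ with one arc $v\to\pi(v)$ for each $v\in V\setminus U$ (each is a directed cycle or a directed path); a component that is not a backstep and consists of the steps at $v_1,\dots,v_k$ is negative if $(-1)^k\prod_{l=1}^k\sigma(i_{v_l})\sigma(j_{v_l})=-1$. Backsteps are not counted in $nc$. *)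

theory Defs
  imports
    "HOL-Library.Poly_Mapping"
    "HOL-Library.FuncSet"
    "HOL-Combinatorics.Permutations"
    "HOL-Combinatorics.Orbits"
    "HOL-Analysis.Determinants"
begin

record ('v, 'e, 'i) ohypergraph =
  verts :: "'v set"
  edges :: "'e set"
  incs :: "'i set"
  port :: "'i \<Rightarrow> 'v"
  attach :: "'i \<Rightarrow> 'e"
  isign :: "'i \<Rightarrow> int"

locale oriented_hypergraph =
  fixes G :: "('v, 'e, 'i) ohypergraph"
  assumes finite_verts: "finite (verts G)"
    and finite_edges: "finite (edges G)"
    and finite_incs: "finite (incs G)"
    and port_in_verts: "i \<in> incs G \<Longrightarrow> port G i \<in> verts G"
    and attach_in_edges: "i \<in> incs G \<Longrightarrow> attach G i \<in> edges G"
    and isign_values: "i \<in> incs G \<Longrightarrow> isign G i \<in> {1, -1}"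

definition incidence_matrix :: "('v, 'e, 'i) ohypergraph \<Rightarrow> 'v \<Rightarrow> 'e \<Rightarrow> int" where
  "incidence_matrix G v e = (\<Sum>i\<in>{i \<in> incs G. port G i = v \<and> attach G i = e}. isign G i)"

definition laplacian :: "('v, 'e, 'i) ohypergraph \<Rightarrow> 'v \<Rightarrow> 'v \<Rightarrow> int" where
  "laplacian G u w = (\<Sum>e\<in>edges G. incidence_matrix G u e * incidence_matrix G w e)"

text \<open>
  The determinant of a matrix indexed by a finite set, which may be empty.  It is the defining
  formula of \<^const>\<open>det\<close>, with the index type replaced by a set.
\<close>

definition det_on :: "'v set \<Rightarrow> ('v \<Rightarrow> 'v \<Rightarrow> 'a::comm_ring_1) \<Rightarrow> 'a" where
  "det_on V A = (\<Sum>p\<in>{p. p permutes V}. of_int (sign p) * (\<Prod>v\<in>V. A v (p v)))"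

lemma det_on_UNIV: "det_on (UNIV :: 'n::finite set) A = det (\<chi> i j. A i j)"
  by (simp add: det_on_def det_def)

text \<open>
  Polynomials over the integers in indeterminates indexed by \<^typ>\<open>'x\<close>: a monomial is a finitely
  supported exponent function, a polynomial a finitely supported family of coefficients, and
  the product is convolution.
\<close>

type_synonym 'x int_mpoly = "('x \<Rightarrow>\<^sub>0 nat) \<Rightarrow>\<^sub>0 int"

definition indet :: "'x \<Rightarrow> 'x int_mpoly" where
  "indet x = Poly_Mapping.single (Poly_Mapping.single x 1) 1"

definition total_minor_poly :: "'v set \<Rightarrow> ('v \<Rightarrow> 'v \<Rightarrow> int) \<Rightarrow> ('v \<times> 'v) int_mpoly" where
  "total_minor_poly V L = det_on V (\<lambda>u w. indet (u, w) - of_int (L u w))"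

text \<open>
  The index set of the outer sum: \<open>[u, w]\<close> is the triple \<open>(U, W, f)\<close> with \<open>f u\<^sub>i = w\<^sub>i\<close>.
  Fixing \<open>f\<close> outside \<open>U\<close> makes each bijection occur once.
\<close>

definition partial_bijections :: "'v set \<Rightarrow> ('v set \<times> 'v set \<times> ('v \<Rightarrow> 'v)) set" where
  "partial_bijections V =
     {(U, W, f). U \<subseteq> V \<and> W \<subseteq> V \<and> card U = card W \<and> f \<in> extensional U \<and> bij_betw f U W}"

text \<open>The step \<open>(v, i\<^sub>v, e\<^sub>v, j\<^sub>v, \<pi> v)\<close>.\<close>

datatype ('v, 'e, 'i) step =
  Step (tail: 'v) (out_inc: 'i) (via: 'e) (in_inc: 'i) (head: 'v)

definition steps_at :: "('v, 'e, 'i) ohypergraph \<Rightarrow> 'v \<Rightarrow> ('v, 'e, 'i) step set" where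
  "steps_at G v =
     {s. tail s = v \<and> head s \<in> verts G \<and> via s \<in> edges G \<and>
         out_inc s \<in> incs G \<and> in_inc s \<in> incs G \<and>
         attach G (out_inc s) = via s \<and> attach G (in_inc s) = via s \<and>
         port G (out_inc s) = v \<and> port G (in_inc s) = head s}"

text \<open>
  The non-zero reduced contributors.  As a set of families of steps it depends on \<open>U\<close> and \<open>W\<close>
  only; the bijection from \<open>U\<close> to \<open>W\<close> enters through the sign.
\<close>

definition reduced_contributors ::
    "('v, 'e, 'i) ohypergraph \<Rightarrow> 'v set \<Rightarrow> 'v set \<Rightarrow> ('v \<Rightarrow> ('v, 'e, 'i) step) set" where
  "reduced_contributors G U W =
     {c \<in> (\<Pi>\<^sub>E v\<in>verts G - U. steps_at G v).
        bij_betw (\<lambda>v. head (c v)) (verts G - U) (verts G - W)}"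

definition edge_monic_contributors ::
    "('v, 'e, 'i) ohypergraph \<Rightarrow> 'v set \<Rightarrow> 'v set \<Rightarrow> ('v \<Rightarrow> ('v, 'e, 'i) step) set" where
  "edge_monic_contributors G U W =
     {c \<in> reduced_contributors G U W.
        \<forall>v\<in>verts G - U. \<forall>w\<in>verts G - U. v \<noteq> w \<longrightarrow> via (c v) \<noteq> via (c w)}"

definition is_backstep :: "('v, 'e, 'i) step \<Rightarrow> bool" where
  "is_backstep s \<longleftrightarrow> out_inc s = in_inc s"

definition backsteps ::
    "('v, 'e, 'i) ohypergraph \<Rightarrow> 'v set \<Rightarrow> ('v \<Rightarrow> ('v, 'e, 'i) step) \<Rightarrow> 'v set" where
  "backsteps G U c = {v \<in> verts G - U. is_backstep (c v)}"

definition completed_perm ::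
    "('v, 'e, 'i) ohypergraph \<Rightarrow> 'v set \<Rightarrow> ('v \<Rightarrow> 'v) \<Rightarrow> ('v \<Rightarrow> ('v, 'e, 'i) step) \<Rightarrow> 'v \<Rightarrow> 'v" where
  "completed_perm G U f c v =
     (if v \<in> U then f v else if v \<in> verts G then head (c v) else v)"

definition even_cycles ::
    "('v, 'e, 'i) ohypergraph \<Rightarrow> 'v set \<Rightarrow> ('v \<Rightarrow> 'v) \<Rightarrow> ('v \<Rightarrow> ('v, 'e, 'i) step) \<Rightarrow> 'v set set" where
  "even_cycles G U f c = {C \<in> orbit (completed_perm G U f c) ` verts G. even (card C)}"

definition arcs ::
    "('v, 'e, 'i) ohypergraph \<Rightarrow> 'v set \<Rightarrow> ('v \<Rightarrow> ('v, 'e, 'i) step) \<Rightarrow> 'v rel" where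
  "arcs G U c = {(v, head (c v)) | v. v \<in> verts G - U}"

text \<open>The weakly connected components, as vertex sets.\<close>

definition contributor_components ::
    "('v, 'e, 'i) ohypergraph \<Rightarrow> 'v set \<Rightarrow> ('v \<Rightarrow> ('v, 'e, 'i) step) \<Rightarrow> 'v set set" where
  "contributor_components G U c = verts G // (arcs G U c \<union> (arcs G U c)\<inverse>)\<^sup>*"

text \<open>
  The steps belonging to a component \<open>C\<close> are those at the vertices of \<open>C - U\<close>.  A backstep
  returns to its own vertex, so a component containing one has only one vertex.
\<close>

definition negative_components ::
    "('v, 'e, 'i) ohypergraph \<Rightarrow> 'v set \<Rightarrow> ('v \<Rightarrow> ('v, 'e, 'i) step) \<Rightarrow> 'v set set" where
  "negative_components G U c =
     {C \<in> contributor_components G U c.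
        \<not> (\<exists>v\<in>backsteps G U c. C = {v}) \<and>
        (-1) ^ card (C - U) * (\<Prod>v\<in>C - U. isign G (out_inc (c v)) * isign G (in_inc (c v))) = -1}"

definition csgn ::
    "('v, 'e, 'i) ohypergraph \<Rightarrow> 'v set \<Rightarrow> ('v \<Rightarrow> 'v) \<Rightarrow> ('v \<Rightarrow> ('v, 'e, 'i) step) \<Rightarrow> int" where
  "csgn G U f c =
     (-1) ^ (card (even_cycles G U f c) + card (negative_components G U c) + card (backsteps G U c))"

end

theory Submission
  imports Defs "HOL-Combinatorics.Cycles"
begin

text \<open>
  Expanding the determinant and every entry \<open>x\<^bsub>v,p v\<^esub> - L\<^bsub>v,p v\<^esub>\<close> gives a sum over a permutation
  \<open>p\<close>, the set \<open>U\<close> of vertices where the indeterminate is taken, and a step from \<open>v\<close> to \<open>p v\<close> for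
  each remaining \<open>v\<close>, which carries the weight \<open>- \<sigma>(i) \<sigma>(j)\<close>.  The sign of \<open>p\<close> is the parity of
  the number of its even cycles.  The product of the weights is collected by components: it is
  \<open>-1\<close> exactly for the negative components and the backsteps.  Hence the coefficient is the sum
  of \<^const>\<open>csgn\<close> over all reduced contributors.  Those that use an edge twice cancel in pairs.
\<close>

section \<open>Sign of a permutation and its cycles of even length\<close>

text \<open>Powers of the cycle rotate the list, so the image of entry \<open>i\<close> under the
  \<open>n\<close>-th power is the entry at \<open>i + n\<close> modulo the length.\<close>

lemma orbit_cycle_of_list:
  assumes "cycle cs" "x \<in> set cs"
  shows "orbit (cycle_of_list cs) x = set cs"
proof -
  obtain i where i: "i < length cs" "x = cs ! i"
    using assms(2) by (auto simp: in_set_conv_nth)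
  have pow: "(cycle_of_list cs ^^ n) x = cs ! ((i + n) mod length cs)" for n
  proof -
    have "(cycle_of_list cs ^^ n) x = map (cycle_of_list cs ^^ n) cs ! i"
      using i by simp
    also have "\<dots> = rotate n cs ! i"
      by (simp only: cyclic_rotation[OF assms(1)])
    finally show ?thesis
      using i by (simp add: nth_rotate add.commute)
  qed
  show ?thesis
  proof (intro equalityI subsetI)
    fix y assume "y \<in> orbit (cycle_of_list cs) x"
    then show "y \<in> set cs"
      using i nth_mem[OF mod_less_divisor, of cs] unfolding orbit_altdef pow by fastforce
  next
    fix y assume "y \<in> set cs"
    then obtain j where j: "j < length cs" "y = cs ! j"
      by (auto simp: in_set_conv_nth)
    \<comment> \<open>Adding \<open>length cs\<close> keeps the exponent positive, as the powers
      that form an \<open>orbit\<close> must be, and does not change the index modulo the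
      length.\<close>
    define n where "n = j + length cs - i"
    have "n > 0" "(i + n) mod length cs = j"
      using i j by (auto simp: n_def)
    then show "y \<in> orbit (cycle_of_list cs) x"
      using j pow[of n] unfolding orbit_altdef by (intro CollectI exI[of _ n]) simp
  qed
qed

text \<open>The cycle is a product of \<open>length cs - 1\<close> transpositions. For the empty
  list the truncated subtraction gives exponent 0, which fits the identity.\<close>

lemma sign_cycle_of_list:
  assumes "cycle cs"
  shows "sign (cycle_of_list cs) = (-1) ^ (length cs - 1)"
  using assms
proof (induction cs rule: cycle_of_list.induct)
  case (1 i j cs)
  have "sign (cycle_of_list (i # j # cs)) = sign (Transposition.transpose i j) * sign (cycle_of_list (j # cs))"
    by (simp only: cycle_of_list.simps sign_compose permutation_swap_id permutation_of_cycle)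
  also have "\<dots> = - ((-1) ^ length cs)"
    using 1 by (simp add: sign_swap_id)
  finally show ?case
    by (simp del: cycle_of_list.simps)
qed simp_all

text \<open>Composing with a disjoint cycle leaves the orbits inside \<open>I\<close> alone and adds
  the single orbit \<open>set cs\<close>, while the sign changes exactly if that orbit has even
  size.\<close>

lemma cycle_decomp_sign:
  assumes "cycle_decomp S p"
  shows "finite S \<and> p permutes S \<and> sign p = (-1) ^ card {C \<in> orbit p ` S. even (card C)}"
  using assms
proof induction
  case empty
  then show ?case by (simp only: permutes_empty sign_id image_empty) simp
next
  case (comp I p cs)
  let ?q = "cycle_of_list cs" and ?A = "{C \<in> orbit p ` I. even (card C)}"
  have fin: "finite I" and p: "p permutes I" and sgn: "sign p = (-1) ^ card ?A"
    using comp.IH by auto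
  have q: "?q permutes set cs"
    by (rule cycle_permutes)
  have perm: "(?q \<circ> p) permutes (set cs \<union> I)"
    using p q by (meson permutes_compose permutes_subset sup_ge1 sup_ge2)
  have orb_cs: "orbit (?q \<circ> p) x = set cs" if "x \<in> set cs" for x
  proof -
    have "p y = y" if "y \<in> set cs" for y
      using comp.hyps that permutes_not_in[OF p] by blast
    then have "orbit (?q \<circ> p) x = orbit ?q x"
      using that q by (intro orbit_cong0[of x "set cs"]) (auto simp: permutes_in_image)
    then show ?thesis
      using orbit_cycle_of_list comp.hyps that by simp
  qed
  have orb_I: "orbit (?q \<circ> p) x = orbit p x" if "x \<in> I" for x
  proof -
    have *: "?q (p y) = p y" if "y \<in> I" for y
    proof (rule permutes_not_in[OF q])
      have "p y \<in> I" using that p by (simp add: permutes_in_image)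
      then show "p y \<notin> set cs" using comp.hyps by blast
    qed
    show ?thesis
      using that p * by (intro orbit_cong0[of x I]) (auto simp: permutes_in_image)
  qed
  have "sign (?q \<circ> p) = (-1) ^ (length cs - 1) * (-1) ^ card ?A"
  proof -
    have "permutation p"
      using p fin permutation_permutes by blast
    then show ?thesis
      using sign_cycle_of_list[OF comp.hyps(2)] sgn by (simp only: sign_compose permutation_of_cycle)
  qed
  also have "\<dots> = (-1) ^ card {C \<in> orbit (?q \<circ> p) ` (set cs \<union> I). even (card C)}"
  \<comment> \<open>The empty list also counts as a cycle, but it contributes no orbit.\<close>
  proof (cases "cs = []")
    case True
    then show ?thesis by simp
  next
    case False
    have img: "orbit (?q \<circ> p) ` (set cs \<union> I) = insert (set cs) (orbit p ` I)"
    proof -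
      have "orbit (?q \<circ> p) ` set cs = {set cs}"
        using False orb_cs by (simp add: image_constant_conv cong: image_cong_simp)
      moreover have "orbit (?q \<circ> p) ` I = orbit p ` I"
        using orb_I by (rule image_cong[OF refl])
      ultimately show ?thesis
        by (simp only: image_Un) simp
    qed
    have "set cs \<notin> orbit p ` I"
    proof
      assume "set cs \<in> orbit p ` I"
      then obtain x where "x \<in> I" "set cs = orbit p x"
        by blast
      then have "set cs \<subseteq> I"
        by (simp only: permutes_orbit_subset[OF p])
      then have "set cs \<inter> I = set cs" by (rule Int_absorb2)
      with comp.hyps(3) have "set cs = {}" by simp
      with False show False by simp
    qed
    then have notin: "set cs \<notin> ?A"
      by simp
    have "card (set cs) = length cs"
      using comp.hyps by (simp add: distinct_card)
    then have eq: "{C \<in> insert (set cs) (orbit p ` I). even (card C)} =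
        (if even (length cs) then insert (set cs) ?A else ?A)"
      by auto
    have "finite ?A"
      using fin by simp
    then have "card (if even (length cs) then insert (set cs) ?A else ?A) =
        (if even (length cs) then Suc (card ?A) else card ?A)"
      using notin by simp
    moreover have "(-1) ^ (length cs - 1) = (if even (length cs) then -1 else 1 :: int)"
      using False by (cases cs) (simp_all add: minus_one_power_iff)
    ultimately show ?thesis
      unfolding img eq by simp
  qed
  finally show ?case
    using fin perm by (intro conjI finite_UnI finite_set)
qed

lemma sign_eq_even_orbits:
  assumes "p permutes S" "finite S"
  shows "sign p = (-1) ^ card {C \<in> orbit p ` S. even (card C)}"
  using cycle_decomp_sign[OF cycle_decomposition[OF assms]] by blast

lemma prod_pm1:
  fixes g :: "'a \<Rightarrow> int"
  assumes "finite A" "\<And>x. x \<in> A \<Longrightarrow> g x \<in> {1, -1}"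
  shows "prod g A = (-1) ^ card {x \<in> A. g x = -1}"
proof -
  have "prod g A = (\<Prod>x\<in>A. if g x = -1 then -1 else 1)"
    using assms(2) by (intro prod.cong) auto
  also have "\<dots> = (-1) ^ card {x \<in> A. g x = -1}"
    using assms(1) by (simp add: prod.If_cases Int_def)
  finally show ?thesis .
qed

section \<open>Step weights, completed permutations and exchanged half-steps\<close>

text \<open>The minus sign is the one in front of the Laplacian. It yields the factor
  \<open>(-1) ^ k\<close> of a component with \<open>k\<close> steps and gives weight -1 to every
  backstep.\<close>

definition step_weight :: "('v, 'e, 'i) ohypergraph \<Rightarrow> ('v, 'e, 'i) step \<Rightarrow> int" where
  "step_weight G s = - (isign G (out_inc s) * isign G (in_inc s))"

lemma bij_betw_completed_perm:
  assumes "U \<subseteq> verts G" "W \<subseteq> verts G" "bij_betw f U W"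
    and "bij_betw (\<lambda>v. head (c v)) (verts G - U) (verts G - W)"
  shows "completed_perm G U f c permutes verts G"
proof (rule bij_imp_permutes)
  have "bij_betw (completed_perm G U f c) U W"
    using assms(3) by (rule iffD1[OF bij_betw_cong, rotated]) (simp add: completed_perm_def)
  moreover have "bij_betw (completed_perm G U f c) (verts G - U) (verts G - W)"
    using assms(4) by (rule iffD1[OF bij_betw_cong, rotated]) (simp add: completed_perm_def)
  ultimately have "bij_betw (completed_perm G U f c) (U \<union> (verts G - U)) (W \<union> (verts G - W))"
    by (rule bij_betw_combine) auto
  then show "bij_betw (completed_perm G U f c) (verts G) (verts G)"
    using assms(1,2) by (simp add: Un_absorb1)
qed (use assms in \<open>auto simp: completed_perm_def\<close>)

text \<open>The edge is kept from \<open>c x\<close>, so the result is a genuine step only if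
  \<open>c x\<close> and \<open>c (r x)\<close> use the same edge. The intended \<open>r\<close> is
  a transposition of two vertices with a common edge.\<close>

definition swap_heads ::
    "('v \<Rightarrow> 'v) \<Rightarrow> ('v \<Rightarrow> ('v, 'e, 'i) step) \<Rightarrow> 'v \<Rightarrow> ('v, 'e, 'i) step" where
  "swap_heads r c x =
     Step (tail (c x)) (out_inc (c x)) (via (c x)) (in_inc (c (r x))) (head (c (r x)))"

lemma finite_partial_bijections: "finite V \<Longrightarrow> finite (partial_bijections V)"
proof (rule finite_subset)
  show "partial_bijections V \<subseteq> (SIGMA U:Pow V. SIGMA W:Pow V. U \<rightarrow>\<^sub>E W)"
    by (auto simp: partial_bijections_def PiE_def bij_betw_def)
  show "finite V \<Longrightarrow> finite (SIGMA U:Pow V. SIGMA W:Pow V. U \<rightarrow>\<^sub>E W)"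
    by (auto intro!: finite_SigmaI finite_PiE dest: finite_subset)
qed

section \<open>Laplacian entries as weighted sums of steps\<close>

context oriented_hypergraph
begin

lemma finite_steps_at: "finite (steps_at G v)"
proof -
  have "steps_at G v \<subseteq> (\<lambda>(i, e, j, w). Step v i e j w) ` (incs G \<times> edges G \<times> incs G \<times> verts G)"
  proof
    fix s assume "s \<in> steps_at G v"
    then show "s \<in> (\<lambda>(i, e, j, w). Step v i e j w) ` (incs G \<times> edges G \<times> incs G \<times> verts G)"
      by (cases s) (auto simp: steps_at_def image_iff)
  qed
  then show ?thesis
    by (rule finite_subset) (simp add: finite_verts finite_edges finite_incs)
qed

lemma step_weight_pm1: "s \<in> steps_at G v \<Longrightarrow> step_weight G s \<in> {1, -1}"
  using isign_values[of "out_inc s"] isign_values[of "in_inc s"]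
  by (auto simp: steps_at_def step_weight_def)

text \<open>Multiplying out the two incidence sums leaves one term for each edge with an incidence
  at \<open>v\<close> and one at \<open>w\<close>, which is the data of a step from \<open>v\<close>
  to \<open>w\<close>. For \<open>v = w\<close> equal incidences are included; these are the
  backsteps.\<close>

lemma laplacian_eq_sum_steps:
  assumes "w \<in> verts G"
  shows "- laplacian G v w = (\<Sum>s\<in>{s \<in> steps_at G v. head s = w}. step_weight G s)"
proof -
  let ?I = "\<lambda>v e. {i \<in> incs G. port G i = v \<and> attach G i = e}"
  have "laplacian G v w = (\<Sum>e\<in>edges G. \<Sum>i\<in>?I v e. \<Sum>j\<in>?I w e. isign G i * isign G j)"
    by (simp add: laplacian_def incidence_matrix_def sum_product)
  also have "\<dots> = (\<Sum>(e, i, j)\<in>(SIGMA e:edges G. ?I v e \<times> ?I w e). isign G i * isign G j)"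
    using finite_edges finite_incs by (simp add: sum.Sigma sum.cartesian_product)
  also have "\<dots> = (\<Sum>s\<in>{s \<in> steps_at G v. head s = w}. isign G (out_inc s) * isign G (in_inc s))"
    using assms
    by (intro sum.reindex_bij_witness[where j = "\<lambda>(e, i, j). Step v i e j w"
          and i = "\<lambda>s. (via s, out_inc s, in_inc s)"]) (auto simp: steps_at_def step.expand)
  finally show ?thesis
    by (simp add: step_weight_def sum_negf)
qed

section \<open>Components and the contributor sign\<close>

text \<open>The components partition the vertex set, so a product over the steps can be grouped by
  component.\<close>

lemma prod_components:
  assumes "c \<in> (\<Pi> v\<in>verts G - U. steps_at G v)"
  shows "(\<Prod>v\<in>verts G - U. g v) = (\<Prod>C\<in>contributor_components G U c. \<Prod>v\<in>C - U. g v)"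
    and "finite (contributor_components G U c)"
    and "\<And>C. C \<in> contributor_components G U c \<Longrightarrow> C \<subseteq> verts G"
proof -
  let ?R = "(arcs G U c \<union> (arcs G U c)\<inverse>)\<^sup>*"
  \<comment> \<open>The closure is reflexive on the whole type, hence an equivalence on
    \<open>UNIV\<close>; by \<open>closed\<close>, the classes of vertices stay inside
    \<open>verts G\<close>.\<close>
  have equiv: "equiv UNIV ?R"
    by (intro equivI) (auto simp: refl_on_def trans_rtrancl sym_Un_converse sym_rtrancl)
  have arcs: "arcs G U c \<subseteq> verts G \<times> verts G"
    using assms by (auto simp: arcs_def steps_at_def Pi_def)
  have closed: "w \<in> verts G" if "(v, w) \<in> ?R" "v \<in> verts G" for v w
    using that(1) by (induction rule: rtrancl_induct) (use that(2) arcs in auto)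
  show sub: "C \<subseteq> verts G" if C: "C \<in> contributor_components G U c" for C
  proof -
    obtain v where "v \<in> verts G" "C = ?R `` {v}"
      using C unfolding contributor_components_def by (rule quotientE)
    then show ?thesis
      using closed by blast
  qed
  have "v \<in> ?R `` {v}" "?R `` {v} \<in> contributor_components G U c" if "v \<in> verts G" for v
    using that unfolding contributor_components_def by (blast intro: quotientI)+
  then have Un: "\<Union> (contributor_components G U c) = verts G"
    using sub by blast
  show fin: "finite (contributor_components G U c)"
    unfolding contributor_components_def quotient_def using finite_verts by simp
  have disj: "C \<inter> D = {}" if "C \<in> contributor_components G U c" "D \<in> contributor_components G U c" "C \<noteq> D" for C D
  proof -
    have "C \<in> UNIV // ?R" "D \<in> UNIV // ?R"
      using that(1,2) unfolding contributor_components_def quotient_def by blast+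
    then show ?thesis
      using quotient_disj[OF equiv] that by blast
  qed
  \<comment> \<open>The default 1 on \<open>U\<close> lets the products run over whole components,
    to which the partition applies.\<close>
  let ?h = "\<lambda>v. if v \<in> U then 1 else g v"
  have h: "prod ?h C = (\<Prod>v\<in>C - U. g v)" if "finite C" for C
    using that by (intro prod.mono_neutral_cong_right) auto
  have fC: "finite C" if "C \<in> contributor_components G U c" for C
    using sub[OF that] finite_verts finite_subset by blast
  have "(\<Prod>v\<in>verts G - U. g v) = prod ?h (\<Union> (contributor_components G U c))"
    using h[of "verts G"] finite_verts Un by simp
  also have "\<dots> = (\<Prod>C\<in>contributor_components G U c. prod ?h C)"
    using fC disj by (subst prod.Union_disjoint) auto
  also have "\<dots> = (\<Prod>C\<in>contributor_components G U c. \<Prod>v\<in>C - U. g v)"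
    using fC by (intro prod.cong refl h)
  finally show "(\<Prod>v\<in>verts G - U. g v) = (\<Prod>C\<in>contributor_components G U c. \<Prod>v\<in>C - U. g v)" .
qed

text \<open>A single incidence has a single port, so a backstep ends where it starts; injectivity of
  the heads rules out arcs arriving from other vertices.\<close>

lemma backstep_component:
  assumes "c \<in> reduced_contributors G U W" "v \<in> backsteps G U c"
  shows "{v} \<in> contributor_components G U c"
proof -
  have v: "v \<in> verts G - U" "out_inc (c v) = in_inc (c v)" "c v \<in> steps_at G v"
    using assms by (auto simp: backsteps_def reduced_contributors_def is_backstep_def)
  then have "head (c v) = v"
    by (auto simp: steps_at_def)
  note v = v(1) this
  have "inj_on (\<lambda>v. head (c v)) (verts G - U)"
    using assms(1) by (auto simp: reduced_contributors_def bij_betw_def)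
  then have inj: "w = v" if "w \<in> verts G - U" "head (c w) = v" for w
    using v that by (simp add: inj_onD)
  have arc: "w = v" if "(v, w) \<in> arcs G U c \<union> (arcs G U c)\<inverse>" for w
    using that v(2) inj unfolding arcs_def by blast
  have "w = v" if "(v, w) \<in> (arcs G U c \<union> (arcs G U c)\<inverse>)\<^sup>*" for w
    using that
  proof (induction rule: rtrancl_induct)
    case (step y z)
    then show ?case using arc by blast
  qed simp
  then have "(arcs G U c \<union> (arcs G U c)\<inverse>)\<^sup>* `` {v} = {v}"
    by auto
  then show ?thesis
    using v(1) quotientI[of v "verts G"] unfolding contributor_components_def by (metis DiffD1)
qed

text \<open>The weight of a component is exactly the expression tested in
  \<open>negative_components\<close>. A component without steps has the empty product 1 and is never
  negative.\<close>

lemma prod_step_weight: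
  assumes "c \<in> reduced_contributors G U W"
  shows "(\<Prod>v\<in>verts G - U. step_weight G (c v)) =
    (-1) ^ (card (negative_components G U c) + card (backsteps G U c))"
proof -
  let ?K = "contributor_components G U c"
  let ?w = "\<lambda>C. \<Prod>v\<in>C - U. step_weight G (c v)"
  have steps: "\<And>v. v \<in> verts G - U \<Longrightarrow> c v \<in> steps_at G v"
    using assms by (auto simp: reduced_contributors_def)
  then have "c \<in> (\<Pi> v\<in>verts G - U. steps_at G v)"
    by blast
  note K = prod_components[OF this]
  have pm1: "?w C \<in> {1, -1}" if "C \<in> ?K" for C
  proof -
    have "finite (C - U)" "\<And>v. v \<in> C - U \<Longrightarrow> step_weight G (c v) \<in> {1, -1}"
      using K(3)[OF that] finite_verts finite_subset steps step_weight_pm1 by blast+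
    then have "?w C = (-1) ^ card {v \<in> C - U. step_weight G (c v) = -1}"
      by (rule prod_pm1)
    then show ?thesis
      by (simp add: minus_one_power_iff)
  qed
  have w_alt: "?w C = (-1) ^ card (C - U) * (\<Prod>v\<in>C - U. isign G (out_inc (c v)) * isign G (in_inc (c v)))" for C
    unfolding step_weight_def by (simp only: prod_uminus)
  have backstep: "?w {v} = -1" if "v \<in> backsteps G U c" for v
  proof -
    have "v \<notin> U" "out_inc (c v) = in_inc (c v)" "isign G (in_inc (c v)) \<in> {1, -1}"
      using that steps isign_values by (auto simp: backsteps_def is_backstep_def steps_at_def)
    then show ?thesis by (auto simp: step_weight_def insert_Diff_if)
  qed
  \<comment> \<open>Backstep components have weight -1 but are excluded from
    \<open>negative_components\<close>, so the union is disjoint and the two counts add.\<close>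
  have "{C \<in> ?K. ?w C = -1} = negative_components G U c \<union> (\<lambda>v. {v}) ` backsteps G U c"
    using backstep_component[OF assms] backstep
    by (auto simp: negative_components_def w_alt[symmetric])
  moreover have "card (negative_components G U c \<union> (\<lambda>v. {v}) ` backsteps G U c) =
      card (negative_components G U c) + card ((\<lambda>v. {v}) ` backsteps G U c)"
    using K(2) finite_verts
    by (intro card_Un_disjoint) (auto simp: negative_components_def backsteps_def)
  moreover have "card ((\<lambda>v. {v}) ` backsteps G U c) = card (backsteps G U c)"
    by (intro card_image) simp
  moreover have "prod ?w ?K = (-1) ^ card {C \<in> ?K. ?w C = -1}"
    by (rule prod_pm1[OF K(2) pm1])
  ultimately show ?thesis
    by (simp only: K(1))
qed

lemma completed_perm_permutes:
  assumes "(U, W, f) \<in> partial_bijections (verts G)" "c \<in> reduced_contributors G U W"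
  shows "completed_perm G U f c permutes verts G"
proof (rule bij_betw_completed_perm)
  show "bij_betw f U W"
    using assms by (simp add: partial_bijections_def)
  show "bij_betw (\<lambda>v. head (c v)) (verts G - U) (verts G - W)"
    using assms by (simp add: reduced_contributors_def)
  show "U \<subseteq> verts G" "W \<subseteq> verts G"
    using assms(1) by (simp_all add: partial_bijections_def)
qed

text \<open>In this form the effect of an exchange on the sign can be computed without following how
  components and backsteps change.\<close>

lemma csgn_eq:
  assumes "(U, W, f) \<in> partial_bijections (verts G)" "c \<in> reduced_contributors G U W"
  shows "csgn G U f c = sign (completed_perm G U f c) * (\<Prod>v\<in>verts G - U. step_weight G (c v))"
  by (simp only: sign_eq_even_orbits[OF completed_perm_permutes[OF assms] finite_verts]
      prod_step_weight[OF assms(2)] csgn_def even_cycles_def power_add mult.assoc)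

section \<open>Cancellation of contributors that repeat an edge\<close>

text \<open>The common edge makes both recombined steps valid, and the heads are only permuted among
  the vertices outside \<open>U\<close>, so their set remains \<open>verts G - W\<close>.\<close>

lemma swap_heads_reduced:
  assumes "c \<in> reduced_contributors G U W"
    and "v \<in> verts G - U" "w \<in> verts G - U" "via (c v) = via (c w)"
  shows "swap_heads (Transposition.transpose v w) c \<in> reduced_contributors G U W"
proof -
  let ?t = "Transposition.transpose v w" and ?X = "verts G - U"
  have t: "?t permutes ?X"
    using assms by (simp add: permutes_swap_id)
  have c: "c x \<in> steps_at G x" if "x \<in> ?X" for x
    using assms(1) that by (auto simp: reduced_contributors_def)
  have "swap_heads ?t c x \<in> steps_at G x" if "x \<in> ?X" for x
  proof -
    have "via (c (?t x)) = via (c x)"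
      using assms(4) by (auto simp: Transposition.transpose_def)
    moreover have "?t x \<in> ?X"
      using that permutes_in_image[OF t] by blast
    ultimately show ?thesis
      using c[OF that] c[of "?t x"] by (auto simp: steps_at_def swap_heads_def)
  qed
  \<comment> \<open>Here the transposition fixes \<open>x\<close>, and rebuilding
    \<open>undefined\<close> from its own selectors returns \<open>undefined\<close>.\<close>
  moreover have "swap_heads ?t c x = undefined" if "x \<notin> ?X" for x
  proof -
    have "?t x = x"
      using that by (rule permutes_not_in[OF t])
    moreover have "c \<in> extensional ?X"
      using assms(1) by (simp add: reduced_contributors_def PiE_def)
    then have "c x = undefined"
      using that by (rule extensional_arb)
    ultimately show ?thesis
      by (simp add: swap_heads_def)
  qed
  moreover have "bij_betw (\<lambda>x. head (swap_heads ?t c x)) ?X (verts G - W)"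
    using bij_betw_trans[OF permutes_imp_bij[OF t], of "\<lambda>v. head (c v)"] assms(1)
    by (simp add: reduced_contributors_def swap_heads_def o_def)
  ultimately show ?thesis
    by (auto simp: reduced_contributors_def intro!: PiE_I)
qed

text \<open>The completed permutation is composed with a transposition, which flips its sign. The
  product of weights is unchanged, because only its in-incidence factors are permuted.\<close>

lemma csgn_swap_heads:
  assumes "(U, W, f) \<in> partial_bijections (verts G)" "c \<in> reduced_contributors G U W"
    and "v \<in> verts G - U" "w \<in> verts G - U" "via (c v) = via (c w)" "v \<noteq> w"
  shows "csgn G U f (swap_heads (Transposition.transpose v w) c) = - csgn G U f c"
proof -
  let ?t = "Transposition.transpose v w" and ?X = "verts G - U"
  have t: "?t permutes ?X"
    using assms by (simp add: permutes_swap_id)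
  have "completed_perm G U f (swap_heads ?t c) = completed_perm G U f c \<circ> ?t"
    using assms by (auto simp: fun_eq_iff completed_perm_def swap_heads_def Transposition.transpose_def)
  moreover have "permutation (completed_perm G U f c)"
    using completed_perm_permutes[OF assms(1,2)] finite_verts permutation_permutes by blast
  ultimately have "sign (completed_perm G U f (swap_heads ?t c)) = - sign (completed_perm G U f c)"
    using assms(6) by (simp only: sign_compose permutation_swap_id sign_swap_id) simp
  moreover have "(\<Prod>x\<in>?X. step_weight G (swap_heads ?t c x)) = (\<Prod>x\<in>?X. step_weight G (c x))"
  proof -
    have "(\<Prod>x\<in>?X. isign G (in_inc (c (?t x)))) = (\<Prod>x\<in>?X. isign G (in_inc (c x)))"
      using prod.permute[OF t, of "\<lambda>x. isign G (in_inc (c x))"] by (simp add: o_def)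
    then show ?thesis
      by (simp add: step_weight_def swap_heads_def prod_uminus prod.distrib)
  qed
  ultimately show ?thesis
    using csgn_eq[OF assms(1,2)] csgn_eq[OF assms(1) swap_heads_reduced[OF assms(2-5)]] by simp
qed

lemma finite_reduced_contributors: "finite (reduced_contributors G U W)"
  by (rule finite_subset[OF _ finite_PiE[of "verts G - U" "steps_at G"]])
    (auto simp: reduced_contributors_def finite_verts finite_steps_at)

text \<open>
  Exchanging the second halves of two steps through a common edge reverses the sign.  The two
  vertices are chosen from the assignment of edges to vertices alone, which the exchange
  preserves, so it is an involution.
\<close>

lemma sum_csgn_edge_monic:
  assumes PB: "(U, W, f) \<in> partial_bijections (verts G)"
  shows "(\<Sum>c\<in>edge_monic_contributors G U W. csgn G U f c) =
    (\<Sum>c\<in>reduced_contributors G U W. csgn G U f c)"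
proof -
  let ?X = "verts G - U"
  let ?S = "reduced_contributors G U W - edge_monic_contributors G U W"
  \<comment> \<open>A contributor in \<open>?S\<close> repeats an edge, so such a transposition
    exists. Choosing it instead of a pair makes the order of the two vertices immaterial.\<close>
  define t where "t c = (SOME r. \<exists>v w. r = Transposition.transpose v w \<and>
      v \<in> ?X \<and> w \<in> ?X \<and> v \<noteq> w \<and> via (c v) = via (c w))" for c :: "'v \<Rightarrow> ('v, 'e, 'i) step"
  have t: "\<exists>v w. t c = Transposition.transpose v w \<and> v \<in> ?X \<and> w \<in> ?X \<and> v \<noteq> w \<and> via (c v) = via (c w)"
    if "c \<in> ?S" for c
  proof -
    have "\<exists>r v w. r = Transposition.transpose v w \<and>
        v \<in> ?X \<and> w \<in> ?X \<and> v \<noteq> w \<and> via (c v) = via (c w)"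
      using that unfolding edge_monic_contributors_def by blast
    then show ?thesis
      unfolding t_def by (rule someI_ex)
  qed
  have t_swap: "t (swap_heads r c) = t c" for r c
    by (simp add: t_def swap_heads_def)
  have inS: "swap_heads (t c) c \<in> ?S" if c: "c \<in> ?S" for c
  proof -
    obtain v w where vw: "t c = Transposition.transpose v w" "v \<in> ?X" "w \<in> ?X" "v \<noteq> w" "via (c v) = via (c w)"
      using t[OF c] by blast
    then have "swap_heads (t c) c \<in> reduced_contributors G U W"
      using c swap_heads_reduced by auto
    moreover have "via (swap_heads (t c) c v) = via (swap_heads (t c) c w)"
      using vw by (simp add: swap_heads_def)
    ultimately show ?thesis
      using vw by (auto simp: edge_monic_contributors_def)
  qed
  have inv: "swap_heads (t (swap_heads (t c) c)) (swap_heads (t c) c) = c" if "c \<in> ?S" for c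
    unfolding t_swap using t[OF that] by (auto simp: fun_eq_iff swap_heads_def step.expand)
  have neg: "csgn G U f (swap_heads (t c) c) = - csgn G U f c" if "c \<in> ?S" for c
    using t[OF that] csgn_swap_heads[OF PB] that by auto
  \<comment> \<open>Reindexing along the sign-reversing involution makes the sum its own negative,
    which over the integers forces zero.\<close>
  have "(\<Sum>c\<in>?S. csgn G U f c) = (\<Sum>c\<in>?S. - csgn G U f c)"
    by (rule sum.reindex_bij_witness[where i = "\<lambda>c. swap_heads (t c) c"
          and j = "\<lambda>c. swap_heads (t c) c"]) (use inS inv neg in auto)
  then have "(\<Sum>c\<in>?S. csgn G U f c) = 0"
    by (simp add: sum_negf)
  moreover have "edge_monic_contributors G U W \<subseteq> reduced_contributors G U W"
    by (simp add: edge_monic_contributors_def)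
  ultimately show ?thesis
    using sum.subset_diff[OF _ finite_reduced_contributors, of "edge_monic_contributors G U W" U W "csgn G U f"]
    by simp
qed

section \<open>Expansion of the determinant and reindexing\<close>

abbreviation steps_between :: "'v \<Rightarrow> 'v \<Rightarrow> ('v, 'e, 'i) step set" where
  "steps_between v w \<equiv> {s \<in> steps_at G v. head s = w}"

text \<open>Two distributive laws are used: \<open>prod_add\<close> selects the set \<open>U\<close>
  where the indeterminate is taken, and \<open>prod_sum_PiE\<close> turns the product of step sums
  into a sum over families of steps.\<close>

lemma total_minor_poly_expand:
  "total_minor_poly (verts G) (laplacian G) =
    (\<Sum>p\<in>{p. p permutes verts G}. \<Sum>U\<in>Pow (verts G).
      \<Sum>c\<in>(\<Pi>\<^sub>E v\<in>verts G - U. steps_between v (p v)).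
        of_int (sign p * (\<Prod>v\<in>verts G - U. step_weight G (c v))) * (\<Prod>u\<in>U. indet (u, p u)))"
proof -
  let ?V = "verts G"
  have "(\<Prod>v\<in>?V. indet (v, p v) - of_int (laplacian G v (p v))) =
      (\<Sum>U\<in>Pow ?V. (\<Prod>u\<in>U. indet (u, p u)) * of_int (\<Sum>c\<in>(\<Pi>\<^sub>E v\<in>?V - U. steps_between v (p v)).
        \<Prod>v\<in>?V - U. step_weight G (c v)))" (is "?lhs = ?rhs")
    if "p permutes ?V" for p
  proof -
    have "?lhs = (\<Prod>v\<in>?V. indet (v, p v) + of_int (- laplacian G v (p v)))"
      by simp
    also have "\<dots> = (\<Sum>U\<in>Pow ?V. (\<Prod>u\<in>U. indet (u, p u)) * (\<Prod>v\<in>?V - U. of_int (- laplacian G v (p v))))"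
      by (rule prod_add[OF finite_verts])
    also have "\<dots> = ?rhs"
    proof (intro sum.cong refl arg_cong2[where f = "(*)"])
      fix U
      have "(\<Prod>v\<in>?V - U. - laplacian G v (p v)) = (\<Prod>v\<in>?V - U. \<Sum>s\<in>steps_between v (p v). step_weight G s)"
        using that by (intro prod.cong refl laplacian_eq_sum_steps) (auto simp: permutes_in_image)
      also have "\<dots> = (\<Sum>c\<in>(\<Pi>\<^sub>E v\<in>?V - U. steps_between v (p v)). \<Prod>v\<in>?V - U. step_weight G (c v))"
        using finite_verts finite_steps_at by (intro prod_sum_PiE) auto
      finally show "(\<Prod>v\<in>?V - U. of_int (- laplacian G v (p v)) :: ('v \<times> 'v) int_mpoly) =
          of_int (\<Sum>c\<in>(\<Pi>\<^sub>E v\<in>?V - U. steps_between v (p v)). \<Prod>v\<in>?V - U. step_weight G (c v))"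
        by (simp only: of_int_prod[symmetric])
    qed
    finally show ?thesis .
  qed
  then show ?thesis
    unfolding total_minor_poly_def det_on_def
    by (intro sum.cong) (auto simp: sum_distrib_left sum_distrib_right ac_simps)
qed

text \<open>From a permutation to a partial bijection: \<open>f\<close> is the restriction of
  \<open>p\<close> to \<open>U\<close>, and the heads of \<open>c\<close> supply the remaining
  values, so \<open>p\<close> can be recovered.\<close>

lemma completed_perm_restrict:
  assumes "p permutes verts G" "U \<subseteq> verts G" "c \<in> (\<Pi>\<^sub>E v\<in>verts G - U. steps_between v (p v))"
  shows "completed_perm G U (restrict p U) c = p"
    and "(U, p ` U, restrict p U) \<in> partial_bijections (verts G)"
    and "c \<in> reduced_contributors G U (p ` U)"
proof -
  have head: "head (c v) = p v" if "v \<in> verts G - U" for v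
    using assms(3) that by auto
  show "completed_perm G U (restrict p U) c = p"
    using head permutes_not_in[OF assms(1)] by (auto simp: fun_eq_iff completed_perm_def)
  have inj: "inj_on p A" for A
    using permutes_inj_on[OF assms(1)] .
  show "(U, p ` U, restrict p U) \<in> partial_bijections (verts G)"
    using assms inj
    by (auto simp: partial_bijections_def permutes_in_image card_image bij_betw_def inj_on_def)
  have "bij_betw p (verts G - U) (verts G - p ` U)"
    using inj permutes_image[OF assms(1)] assms(2) image_set_diff[OF permutes_inj[OF assms(1)]]
    by (simp add: bij_betw_def)
  then have "bij_betw (\<lambda>v. head (c v)) (verts G - U) (verts G - p ` U)"
    by (rule iffD1[OF bij_betw_cong, rotated]) (simp add: head)
  then show "c \<in> reduced_contributors G U (p ` U)"
    using assms(3) by (auto simp: reduced_contributors_def PiE_iff)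
qed

text \<open>The way back: the completed permutation determines \<open>W\<close> as the image of
  \<open>U\<close>, and \<open>f\<close> as its restriction, since \<open>f\<close> is
  extensional.\<close>

lemma completed_perm_image_restrict:
  assumes "(U, W, f) \<in> partial_bijections (verts G)" "c \<in> reduced_contributors G U W"
  shows "completed_perm G U f c ` U = W"
    and "restrict (completed_perm G U f c) U = f"
    and "c \<in> (\<Pi>\<^sub>E v\<in>verts G - U. steps_between v (completed_perm G U f c v))"
  using assms
  by (auto simp: partial_bijections_def reduced_contributors_def completed_perm_def bij_betw_def
      PiE_iff fun_eq_iff extensional_def)

theorem total_minor_poly_laplacian:
  "total_minor_poly (verts G) (laplacian G) =
    (\<Sum>(U, W, f)\<in>partial_bijections (verts G).
       of_int (\<Sum>c\<in>edge_monic_contributors G U W. csgn G U f c) *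
       (\<Prod>u\<in>U. indet (u, f u)))"
proof -
  let ?V = "verts G"
  let ?term = "\<lambda>(p, U, c).
    of_int (sign p * (\<Prod>v\<in>?V - U. step_weight G (c v))) * (\<Prod>u\<in>U. indet (u, p u)) :: ('v \<times> 'v) int_mpoly"
  let ?A = "SIGMA p:{p. p permutes ?V}. SIGMA U:Pow ?V. \<Pi>\<^sub>E v\<in>?V - U. steps_between v (p v)"
  let ?B = "SIGMA (U, W, f):partial_bijections ?V. reduced_contributors G U W"
  have "total_minor_poly ?V (laplacian G) = sum ?term ?A"
    unfolding total_minor_poly_expand using finite_verts finite_steps_at
    by (simp add: sum.Sigma finite_permutations finite_PiE finite_SigmaI)
  \<comment> \<open>The two index sets correspond through the completed permutation, and
    \<open>csgn_eq\<close> matches the coefficients.\<close>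
  also have "\<dots> = (\<Sum>((U, W, f), c)\<in>?B. of_int (csgn G U f c) * (\<Prod>u\<in>U. indet (u, f u)))"
  proof (rule sum.reindex_bij_witness[where i = "\<lambda>((U, W, f), c). (completed_perm G U f c, U, c)"
        and j = "\<lambda>(p, U, c). ((U, p ` U, restrict p U), c)"])
    fix a assume "a \<in> ?A"
    then obtain p U c where a: "a = (p, U, c)" and pUc: "p permutes ?V" "U \<subseteq> ?V"
      "c \<in> (\<Pi>\<^sub>E v\<in>?V - U. steps_between v (p v))"
      by auto
    note facts = completed_perm_restrict[OF pUc]
    show "(\<lambda>((U, W, f), c). (completed_perm G U f c, U, c)) ((\<lambda>(p, U, c). ((U, p ` U, restrict p U), c)) a) = a"
      using facts by (simp add: a)
    show "(\<lambda>(p, U, c). ((U, p ` U, restrict p U), c)) a \<in> ?B"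
      using facts by (simp add: a)
    show "(\<lambda>((U, W, f), c). of_int (csgn G U f c) * (\<Prod>u\<in>U. indet (u, f u)))
        ((\<lambda>(p, U, c). ((U, p ` U, restrict p U), c)) a) = ?term a"
      using csgn_eq[OF facts(2,3)] facts(1) by (simp add: a)
  next
    fix b assume "b \<in> ?B"
    then obtain U W f c where b: "b = ((U, W, f), c)"
      and UWf: "(U, W, f) \<in> partial_bijections ?V" "c \<in> reduced_contributors G U W"
      by auto
    note facts = completed_perm_image_restrict[OF UWf] completed_perm_permutes[OF UWf]
    show "(\<lambda>(p, U, c). ((U, p ` U, restrict p U), c)) ((\<lambda>((U, W, f), c). (completed_perm G U f c, U, c)) b) = b"
      using facts by (simp add: b)
    show "(\<lambda>((U, W, f), c). (completed_perm G U f c, U, c)) b \<in> ?A"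
      using facts UWf by (auto simp: b partial_bijections_def)
  qed
  also have "\<dots> = (\<Sum>(U, W, f)\<in>partial_bijections ?V.
      \<Sum>c\<in>reduced_contributors G U W. of_int (csgn G U f c) * (\<Prod>u\<in>U. indet (u, f u)))"
    using finite_partial_bijections[OF finite_verts] finite_reduced_contributors
    by (subst sum.Sigma[symmetric]) (auto intro!: sum.cong)
  also have "\<dots> = (\<Sum>(U, W, f)\<in>partial_bijections ?V.
      of_int (\<Sum>c\<in>edge_monic_contributors G U W. csgn G U f c) * (\<Prod>u\<in>U. indet (u, f u)))"
    by (rule sum.cong) (auto simp: sum_csgn_edge_monic simp flip: sum_distrib_right of_int_sum)
  finally show ?thesis .
qed

end

theorem theorem2p2p4:
  fixes G :: "('v, 'e, 'i) ohypergraph"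
  assumes "oriented_hypergraph G"
  shows "total_minor_poly (verts G) (laplacian G) =
    (\<Sum>(U, W, f)\<in>partial_bijections (verts G).
       of_int (\<Sum>c\<in>edge_monic_contributors G U W. csgn G U f c) *
       (\<Prod>u\<in>U. indet (u, f u)))"
  using assms by (rule oriented_hypergraph.total_minor_poly_laplacian)

end
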